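(* Consider the following instance of the two-observer sequential detection problem described in the context: $P(H=0)=P(H=1)=1/2$, $T=3$, $k=1$, $1<K<2$. Observer 1 has $\mathcal Y^1=\{0,1\}$ with $$P(Y^1_t=0|H=0)=P(Y^1_t=1|H=1)=q_t,\qquad P(Y^1_t=1|H=0)=P(Y^1_t=0|H=1)=1-q_t,$$ where $q_1=q_2=1/2$, $q_3=1$. Observer 2 has $\mathcal Y^2=\{0,1,2\}$ with $$P(Y^2_t=0|H=0)=r_t,\quad P(Y^2_t=1|H=0)=1-r_t,\quad P(Y^2_t=2|H=0)=0,$$ $$P(Y^2_t=0|H=1)=0,\quad P(Y^2_t=1|H=1)=1-r_t,\quad P(Y^2_t=2|H=1)=r_t,$$ where $r_2=r_3=0$ and $0<r_1<1$. Assume the error costs $J(0,1)$ and $J(1,0)$ are sufficiently high that every pair of policies whose final decision differs from $H$ with nonzero probability has expected cost greater than $2$. Then: (i) The lowest value of the expected cost $\mathcal J(\Gamma^1,\Gamma^2)$ achievable when observer 2 is restricted to use a two-threshold rule at time $t=1$ is $$\min\{\,r_1+(1-r_1)(K+1),\;2-r_1/2\,\}.$$ (ii) The lowest expected cost achievable when observer 2 uses at time $t=1$ the rule $$U^2_1=\begin{cases} 1 & \text{if }\Pi^2_1=0, \\ 0 & \text{if }0<\Pi^2_1<1, \\ b & \text{if }\Pi^2_1=1 \end{cases}$$ is $\mathcal J^*=2(1-r_1)+r_1(K+1)/2$. (iii) If moreover $r_1<2/3$, then $\mathcal J^*<\min\{\,r_1+(1-r_1)(K+1),\;2-r_1/2\,\}$.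 Consequently, for $1<K<2$ and $0<r_1<2/3$, no pair of policies in which observer 2 uses a two-threshold rule at time $t=1$ is optimal.
   Context: Setting. A hypothesis $H\in\{0,1\}$ has known prior. Observer $i\in\{1,2\}$ can make observations $Y^i_1,Y^i_2,\dots$ with values in $\mathcal Y^i$. Given $H$, the observations of each observer at different times are independent, and the two observation sequences are independent of each other. Decisions. At time $t$ a still-active observer $i$ chooses $U^i_t\in\{0,1,b\}$, where $b$ (blank) means continue, by $$U^i_t=\gamma^i_t(Y^i_{1:t},U^1_{1:t-1},U^2_{1:t-1}),$$ where $X_{1:t}$ denotes $X_1,\dots,X_t$. The collection $\Gamma^i=(\gamma^i_1,\dots,\gamma^i_T)$ is the policy of observer $i$. Let $\tau^i=\min\{t:U^i_t\ne b\}$. After $\tau^i$, observer $i$ takes no further observations and makes no further decisions. There is a finite horizon $T$, and policies must satisfy $\tau^1\le T$, $\tau^2\le T$ (so an observer active at time $T$ must choose $0$ or $1$). Cost. Let $\tau^{\min}=\min\{\tau^1,\tau^2\}$, $\tau^{\max}=\max\{\tau^1,\tau^2\}$, and $L=1$ if $\tau^2<\tau^1$, $L=2$ if $\tau^2\ge\tau^1$. The final decision is $U^L_{\tau^{\max}}$. With constants $K>k>0$ and a non-negative function $J(\cdot,\cdot)$ on $\{0,1\}^2$ with $J(0,0)=J(1,1)=0$, the expected cost is $$\mathcal J(\Gamma^1,\Gamma^2)=\mathbb E^{\Gamma^1,\Gamma^2}\left[K(\tau^{\min}-1)+k(\tau^{\max}-\tau^{\min})+J(U^L_{\tau^{\max}},H)\right].$$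 A pair $(\Gamma^1,\Gamma^2)$ is optimal if it minimizes $\mathcal J$. Belief and two-threshold rules. $\Pi^2_1=P(H=0|Y^2_1)$ is observer 2's posterior belief at time 1. A two-threshold rule at time $t=1$ for observer 2 is a rule of the form: $U^2_1=1$ if $\Pi^2_1\le\alpha$, $U^2_1=b$ if $\alpha<\Pi^2_1<\beta$, $U^2_1=0$ if $\Pi^2_1\ge\beta$, for real numbers $\alpha\le\beta$ in $[0,1]$ (if $\alpha=\beta$, the decision at $\Pi^2_1=\alpha$ is either one of $0$, $1$). *)

theory Defs
  imports "HOL-Probability.Probability" "HOL-Library.Z2"
begin

text \<open>
  Hypotheses and terminal decisions are elements of the two-element type \<^typ>\<open>bit\<close>; a decision is
  an element of \<^typ>\<open>bit option\<close>, where \<^term>\<open>None\<close> is the blank symbol b (continue).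
  A policy is the family of maps sending t, the list of the observer's own observations at times
  1, ..., t and the lists of both observers' decisions at times 1, ..., t - 1 to the
  decision at time t.
\<close>

type_synonym decision = "bit option"

type_synonym 'a policy = "nat \<Rightarrow> 'a list \<Rightarrow> decision list \<Rightarrow> decision list \<Rightarrow> decision"

text \<open>
  The decision lists are padded with \<^term>\<open>None\<close> after an observer has stopped. This carries no
  information beyond the stopping decision itself, which the list already contains.
\<close>

definition decide :: "'a policy \<Rightarrow> nat \<Rightarrow> (nat \<Rightarrow> 'a) \<Rightarrow> decision list \<Rightarrow> decision list \<Rightarrow> decision list \<Rightarrow> decision"
  where "decide g t y own u1 u2 =
    (if set own \<subseteq> {None} then g t (map y [1..<Suc t]) u1 u2 else None)"

fun history :: "'a policy \<times> 'b policy \<Rightarrow> (nat \<Rightarrow> 'a) \<Rightarrow> (nat \<Rightarrow> 'b) \<Rightarrow> nat \<Rightarrow> decision list \<times> decision list"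
  where
    "history p y1 y2 0 = ([], [])"
  | "history p y1 y2 (Suc t) = (let (u1, u2) = history p y1 y2 t in
       (u1 @ [decide (fst p) (Suc t) y1 u1 u1 u2],
        u2 @ [decide (snd p) (Suc t) y2 u2 u1 u2]))"

definition U1 :: "'a policy \<times> 'b policy \<Rightarrow> (nat \<Rightarrow> 'a) \<Rightarrow> (nat \<Rightarrow> 'b) \<Rightarrow> nat \<Rightarrow> decision"
  where "U1 p y1 y2 t = last (fst (history p y1 y2 t))"

definition U2 :: "'a policy \<times> 'b policy \<Rightarrow> (nat \<Rightarrow> 'a) \<Rightarrow> (nat \<Rightarrow> 'b) \<Rightarrow> nat \<Rightarrow> decision"
  where "U2 p y1 y2 t = last (snd (history p y1 y2 t))"

definition stop_time :: "(nat \<Rightarrow> decision) \<Rightarrow> nat"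
  where "stop_time U = (LEAST t. 1 \<le> t \<and> U t \<noteq> None)"

text \<open>The explicit existence clause is needed because \<^const>\<open>Least\<close> is unspecified for an observer
  that never stops.\<close>

definition stops_by :: "(nat \<Rightarrow> decision) \<Rightarrow> nat \<Rightarrow> bool"
  where "stops_by U T \<longleftrightarrow> (\<exists>t. 1 \<le> t \<and> U t \<noteq> None) \<and> stop_time U \<le> T"

definition final_decision :: "'a policy \<times> 'b policy \<Rightarrow> (nat \<Rightarrow> 'a) \<Rightarrow> (nat \<Rightarrow> 'b) \<Rightarrow> bit"
  where "final_decision p y1 y2 =
    (let tau1 = stop_time (U1 p y1 y2); tau2 = stop_time (U2 p y1 y2); taumax = max tau1 tau2
     in the (if tau2 < tau1 then U1 p y1 y2 taumax else U2 p y1 y2 taumax))"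

definition cost :: "real \<Rightarrow> real \<Rightarrow> (bit \<Rightarrow> bit \<Rightarrow> real) \<Rightarrow> 'a policy \<times> 'b policy
    \<Rightarrow> bit \<Rightarrow> (nat \<Rightarrow> 'a) \<Rightarrow> (nat \<Rightarrow> 'b) \<Rightarrow> real"
  where "cost K k J p h y1 y2 =
    (let tau1 = stop_time (U1 p y1 y2); tau2 = stop_time (U2 p y1 y2);
         taumin = real (min tau1 tau2); taumax = real (max tau1 tau2)
     in K * (taumin - 1) + k * (taumax - taumin) + J (final_decision p y1 y2) h)"

text \<open>The model for discrete observations, with conditional independence given H expressed by
  independence under the conditional measures. Only observations up to the horizon T matter. The
  two observation alphabets are subsets of one countable type because \<^const>\<open>prob_space.indep_var\<close>
  relates random variables of the same type.\<close>

locale two_observer_detection = prob_space M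
  for M :: "'w measure" +
  fixes H :: "'w \<Rightarrow> bit"
    and Y1 Y2 :: "nat \<Rightarrow> 'w \<Rightarrow> 'a::countable"
    and T :: nat
    and K k :: real
    and J :: "bit \<Rightarrow> bit \<Rightarrow> real"
  assumes H_measurable: "H \<in> measurable M (count_space UNIV)"
    and Y1_measurable: "\<And>t. t \<in> {1..T} \<Longrightarrow> Y1 t \<in> measurable M (count_space UNIV)"
    and Y2_measurable: "\<And>t. t \<in> {1..T} \<Longrightarrow> Y2 t \<in> measurable M (count_space UNIV)"
    and Y1_cond_indep: "\<And>h. prob {w \<in> space M. H w = h} > 0 \<Longrightarrow>
      prob_space.indep_vars (uniform_measure M {w \<in> space M. H w = h})
        (\<lambda>_. count_space UNIV) Y1 {1..T}"
    and Y2_cond_indep: "\<And>h. prob {w \<in> space M. H w = h} > 0 \<Longrightarrow>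
      prob_space.indep_vars (uniform_measure M {w \<in> space M. H w = h})
        (\<lambda>_. count_space UNIV) Y2 {1..T}"
    and Y1_Y2_cond_indep: "\<And>h. prob {w \<in> space M. H w = h} > 0 \<Longrightarrow>
      prob_space.indep_var (uniform_measure M {w \<in> space M. H w = h})
        (PiM {1..T} (\<lambda>_. count_space UNIV)) (\<lambda>w. \<lambda>t\<in>{1..T}. Y1 t w)
        (PiM {1..T} (\<lambda>_. count_space UNIV)) (\<lambda>w. \<lambda>t\<in>{1..T}. Y2 t w)"
    and k_pos: "k > 0"
    and K_gt_k: "K > k"
    and J_nonneg: "\<And>u h. J u h \<ge> 0"
    and J_correct: "J 0 0 = 0" "J 1 1 = 0"

definition policy_pairs :: "'w measure \<Rightarrow> (nat \<Rightarrow> 'w \<Rightarrow> 'a) \<Rightarrow> (nat \<Rightarrow> 'w \<Rightarrow> 'b) \<Rightarrow> nat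
    \<Rightarrow> ('a policy \<times> 'b policy) set"
  where "policy_pairs M Y1 Y2 T =
    {p. \<forall>w \<in> space M. stops_by (U1 p (\<lambda>t. Y1 t w) (\<lambda>t. Y2 t w)) T
                    \<and> stops_by (U2 p (\<lambda>t. Y1 t w) (\<lambda>t. Y2 t w)) T}"

definition error_prob :: "'w measure \<Rightarrow> ('w \<Rightarrow> bit) \<Rightarrow> (nat \<Rightarrow> 'w \<Rightarrow> 'a) \<Rightarrow> (nat \<Rightarrow> 'w \<Rightarrow> 'b)
    \<Rightarrow> 'a policy \<times> 'b policy \<Rightarrow> real"
  where "error_prob M H Y1 Y2 p =
    \<P>(w in M. final_decision p (\<lambda>t. Y1 t w) (\<lambda>t. Y2 t w) \<noteq> H w)"

definition expected_cost :: "'w measure \<Rightarrow> ('w \<Rightarrow> bit) \<Rightarrow> (nat \<Rightarrow> 'w \<Rightarrow> 'a) \<Rightarrow> (nat \<Rightarrow> 'w \<Rightarrow> 'b)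
    \<Rightarrow> real \<Rightarrow> real \<Rightarrow> (bit \<Rightarrow> bit \<Rightarrow> real) \<Rightarrow> 'a policy \<times> 'b policy \<Rightarrow> real"
  where "expected_cost M H Y1 Y2 K k J p =
    (LINT w|M. cost K k J p (H w) (\<lambda>t. Y1 t w) (\<lambda>t. Y2 t w))"

definition lowest_cost :: "('p \<Rightarrow> real) \<Rightarrow> 'p set \<Rightarrow> real \<Rightarrow> bool"
  where "lowest_cost C P v \<longleftrightarrow> (\<exists>p. is_arg_min C (\<lambda>p. p \<in> P) p \<and> C p = v)"

text \<open>The belief of observer 2 at time 1, as a function of the observed value. The elementary
  conditional probability is adequate since observations are discrete.\<close>

definition belief :: "'w measure \<Rightarrow> ('w \<Rightarrow> bit) \<Rightarrow> (nat \<Rightarrow> 'w \<Rightarrow> 'b) \<Rightarrow> 'b \<Rightarrow> real"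
  where "belief M H Y2 y = \<P>(w in M. H w = 0 \<bar> Y2 1 w = y)"

definition uses_rule :: "'w measure \<Rightarrow> ('w \<Rightarrow> bit) \<Rightarrow> (nat \<Rightarrow> 'w \<Rightarrow> 'a) \<Rightarrow> (nat \<Rightarrow> 'w \<Rightarrow> 'b)
    \<Rightarrow> (real \<Rightarrow> decision) \<Rightarrow> 'a policy \<times> 'b policy \<Rightarrow> bool"
  where "uses_rule M H Y1 Y2 \<rho> p \<longleftrightarrow>
    (\<forall>w \<in> space M. U2 p (\<lambda>t. Y1 t w) (\<lambda>t. Y2 t w) 1 = \<rho> (belief M H Y2 (Y2 1 w)))"

definition two_threshold :: "(real \<Rightarrow> decision) \<Rightarrow> bool"
  where "two_threshold \<rho> \<longleftrightarrow> (\<exists>\<alpha> \<beta>. 0 \<le> \<alpha> \<and> \<alpha> \<le> \<beta> \<and> \<beta> \<le> 1 \<and>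
    (\<forall>\<pi> \<in> {0..1}.
       (\<alpha> < \<beta> \<longrightarrow> \<rho> \<pi> = (if \<pi> \<le> \<alpha> then Some 1 else if \<pi> < \<beta> then None else Some 0)) \<and>
       (\<alpha> = \<beta> \<longrightarrow> (\<pi> < \<alpha> \<longrightarrow> \<rho> \<pi> = Some 1) \<and> (\<pi> > \<alpha> \<longrightarrow> \<rho> \<pi> = Some 0)
                    \<and> (\<pi> = \<alpha> \<longrightarrow> \<rho> \<pi> \<in> {Some 0, Some 1}))))"

end

theory Submission
  imports Defs
begin

text \<open>
  Only observer 1 ever learns H for certain, at time 3, and observer 2's first observation either
  reveals H or carries no information. A pair with error probability 0 must therefore,
  when that first observation is uninformative, let observer 1 run until time 3 and observer 2 stop
  earlier; this forces observer 1 to stay active at time 1 in every case, and at time 2 whenever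
  observer 2's first decision is the one it takes when uninformed. So the cost of such a pair is
  bounded below in terms of observer 2's rule at time 1 alone, and the bounds are attained by letting
  observer 1 decode observer 2's first decision. The rule of part (ii) encodes one revealing
  observation by stopping with 1, the uninformed case by stopping with 0 and the other revealing
  observation by continuing, which no two-threshold rule does. Pairs that err with positive
  probability cost more than 2 by hypothesis.
\<close>

section \<open>Decisions and costs along a path\<close>

lemma atLeastAtMost_1_3: "{1..3::nat} = {1, 2, 3}"
  by auto

lemma U1_numeral:
  "U1 p y1 y2 (Suc 0) = fst p 1 [y1 1] [] []"
  "U1 p y1 y2 2 = (if U1 p y1 y2 1 = None then fst p 2 [y1 1, y1 2] [U1 p y1 y2 1] [U2 p y1 y2 1] else None)"
  "U1 p y1 y2 3 = (if U1 p y1 y2 1 = None \<and> U1 p y1 y2 2 = None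
     then fst p 3 [y1 1, y1 2, y1 3] [U1 p y1 y2 1, U1 p y1 y2 2] [U2 p y1 y2 1, U2 p y1 y2 2] else None)"
  by (auto simp: U1_def U2_def decide_def numeral_eq_Suc upt_rec Let_def split_beta)

lemma U2_numeral:
  "U2 p y1 y2 (Suc 0) = snd p 1 [y2 1] [] []"
  "U2 p y1 y2 2 = (if U2 p y1 y2 1 = None then snd p 2 [y2 1, y2 2] [U1 p y1 y2 1] [U2 p y1 y2 1] else None)"
  "U2 p y1 y2 3 = (if U2 p y1 y2 1 = None \<and> U2 p y1 y2 2 = None
     then snd p 3 [y2 1, y2 2, y2 3] [U1 p y1 y2 1, U1 p y1 y2 2] [U2 p y1 y2 1, U2 p y1 y2 2] else None)"
  by (auto simp: U1_def U2_def decide_def numeral_eq_Suc upt_rec Let_def split_beta)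

lemma stops_by_iff: "stops_by U T \<longleftrightarrow> (\<exists>t\<in>{1..T}. U t \<noteq> None)"
proof
  assume "stops_by U T"
  then show "\<exists>t\<in>{1..T}. U t \<noteq> None"
    unfolding stops_by_def stop_time_def by (metis (mono_tags, lifting) LeastI atLeastAtMost_iff)
next
  assume "\<exists>t\<in>{1..T}. U t \<noteq> None"
  then obtain t where t: "1 \<le> t" "t \<le> T" "U t \<noteq> None" by auto
  then have "stop_time U \<le> t" unfolding stop_time_def by (intro Least_le) auto
  with t show "stops_by U T" unfolding stops_by_def by auto
qed

lemma stop_timeI:
  assumes "1 \<le> t" "U t \<noteq> None" "\<And>s. 1 \<le> s \<Longrightarrow> s < t \<Longrightarrow> U s = None"
  shows "stop_time U = t"
  unfolding stop_time_def using assms by (intro Least_equality) (auto simp: not_less[symmetric])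

lemma stops_by_3_iff: "stops_by U 3 \<longleftrightarrow> U 1 \<noteq> None \<or> U 2 \<noteq> None \<or> U 3 \<noteq> None"
  unfolding stops_by_iff atLeastAtMost_1_3 by simp

lemma stop_time_3:
  assumes "stops_by U 3"
  shows "stop_time U = (if U 1 \<noteq> None then 1 else if U 2 \<noteq> None then 2 else 3)"
proof -
  have *: "s = 1" if "1 \<le> s" "s < 2" for s :: nat using that by auto
  have **: "s = 1 \<or> s = 2" if "1 \<le> s" "s < 3" for s :: nat using that by auto
  show ?thesis
    using assms by (auto simp: stops_by_3_iff intro!: stop_timeI dest!: * **)
qed

lemma U_cong_3:
  assumes "\<And>t. t \<in> {1..3} \<Longrightarrow> y1 t = z1 t" "\<And>t. t \<in> {1..3} \<Longrightarrow> y2 t = z2 t" "t \<in> {1..3}"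
  shows "U1 p y1 y2 t = U1 p z1 z2 t" "U2 p y1 y2 t = U2 p z1 z2 t"
proof -
  have "t = 1 \<or> t = 2 \<or> t = 3" using assms(3) by auto
  with assms(1,2) show "U1 p y1 y2 t = U1 p z1 z2 t" "U2 p y1 y2 t = U2 p z1 z2 t"
    by (auto simp: U1_numeral U2_numeral)
qed

context
  fixes p :: "'a policy \<times> 'b policy" and y1 z1 :: "nat \<Rightarrow> 'a" and y2 z2 :: "nat \<Rightarrow> 'b"
  assumes eq: "\<And>t. t \<in> {1..3} \<Longrightarrow> y1 t = z1 t" "\<And>t. t \<in> {1..3} \<Longrightarrow> y2 t = z2 t"
begin

lemma stops_by_cong_3:
  "stops_by (U1 p y1 y2) 3 = stops_by (U1 p z1 z2) 3"
  "stops_by (U2 p y1 y2) 3 = stops_by (U2 p z1 z2) 3"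
  using U_cong_3[OF eq, where p = p] by (simp_all add: stops_by_3_iff)

text \<open>The model constrains observations only up to time 3, so paths are compared on
  \<open>{1..3}\<close> alone. Without stopping by time 3, \<open>stop_time\<close> could depend on
  later observations or be unspecified.\<close>

lemma
  assumes stops: "stops_by (U1 p y1 y2) 3" "stops_by (U2 p y1 y2) 3"
  shows final_decision_cong_3: "final_decision p y1 y2 = final_decision p z1 z2"
    and cost_cong_3: "cost K k J p h y1 y2 = cost K k J p h z1 z2"
proof -
  have U: "U1 p y1 y2 t = U1 p z1 z2 t" "U2 p y1 y2 t = U2 p z1 z2 t" if "t \<in> {1..3}" for t
    using U_cong_3[of y1 z1 y2 z2] eq that by blast+
  have stop_eq: "stop_time (U1 p y1 y2) = stop_time (U1 p z1 z2)" "stop_time (U2 p y1 y2) = stop_time (U2 p z1 z2)"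
    using stops stops_by_cong_3 U by (simp_all add: stop_time_3)
  have "max (stop_time (U1 p y1 y2)) (stop_time (U2 p y1 y2)) \<in> {1..3}"
    using stops by (simp add: stop_time_3)
  then show fd: "final_decision p y1 y2 = final_decision p z1 z2"
    by (simp only: final_decision_def Let_def stop_eq[symmetric] U)
  with stop_eq
  show "cost K k J p h y1 y2 = cost K k J p h z1 z2" by (simp add: cost_def)
qed

end

text \<open>Observer 1's third observation is seen by nobody else before the horizon, so a final decision
  that depends on it must be observer 1's own decision at time 3.\<close>

lemma final_decision_differs_imp:
  assumes eq: "y1 1 = z1 1" "y1 2 = z1 2"
    and stops: "stops_by (U1 p y1 y2) 3" "stops_by (U2 p y1 y2) 3"
      "stops_by (U1 p z1 y2) 3" "stops_by (U2 p z1 y2) 3"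
    and differ: "final_decision p y1 y2 \<noteq> final_decision p z1 y2"
  shows "U1 p y1 y2 1 = None" "U1 p y1 y2 2 = None" "U2 p y1 y2 1 \<noteq> None \<or> U2 p y1 y2 2 \<noteq> None"
proof -
  have U12: "U1 p y1 y2 1 = U1 p z1 y2 1" "U1 p y1 y2 2 = U1 p z1 y2 2"
    "U2 p y1 y2 1 = U2 p z1 y2 1" "U2 p y1 y2 2 = U2 p z1 y2 2"
    using eq by (simp_all add: U1_numeral U2_numeral)
  then have U3: "U2 p y1 y2 3 = U2 p z1 y2 3"
    by (simp add: U2_numeral(3))
  \<comment> \<open>If observer 1 stopped before time 3, or observer 2 stayed active until time 3 (a
    tie goes to observer 2), the final decision would be among those just shown to agree on both
    paths.\<close>
  have "U1 p y1 y2 1 = None \<and> U1 p y1 y2 2 = None \<and> (U2 p y1 y2 1 \<noteq> None \<or> U2 p y1 y2 2 \<noteq> None)"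
    using differ stops U12 U3 unfolding final_decision_def Let_def
    by (auto simp: stop_time_3 split: if_splits)
  then show "U1 p y1 y2 1 = None" "U1 p y1 y2 2 = None" "U2 p y1 y2 1 \<noteq> None \<or> U2 p y1 y2 2 \<noteq> None"
    by auto
qed

section \<open>Lower bounds for the cost of correct pairs\<close>

text \<open>With the parameters of the instance, the paths of positive probability under H = h are the
  pairs of \<open>signal1 a b h\<close> (two coin tosses, then h itself) and \<open>signal2 c\<close>, where c is either
  the uninformative value 1 or the value \<open>revealing h\<close>.\<close>

definition signal1 :: "nat \<Rightarrow> nat \<Rightarrow> bit \<Rightarrow> nat \<Rightarrow> nat"
  where "signal1 a b h = (\<lambda>t\<in>{1..3}. if t = 1 then a else if t = 2 then b else if h = 0 then 0 else 1)"

definition signal2 :: "nat \<Rightarrow> nat \<Rightarrow> nat"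
  where "signal2 c = (\<lambda>t\<in>{1..3}. if t = 1 then c else 1)"

definition revealing :: "bit \<Rightarrow> nat"
  where "revealing h = (if h = 0 then 0 else 2)"

definition first_rule :: "'a policy \<times> 'b policy \<Rightarrow> 'b \<Rightarrow> decision"
  where "first_rule p c = snd p 1 [c] [] []"

text \<open>On \<open>signal2 1\<close> the paths of the two hypotheses differ only in observer 1's
  third observation, so correctness makes observer 1 wait until time 3 and observer 2 stop earlier.
  On a revealing signal observer 1 can leave this course only after seeing observer 2 announce
  something else. The bound \<open>K\<close> is not sharp when both announcements are blank, a case
  that none of the rules studied below produces.\<close>

lemma cost_lower_bounds:
  assumes K: "1 < K"
    and J: "J 0 0 = 0" "J 1 1 = 0"
    and stops: "\<And>h c. c \<in> {1, revealing h} \<Longrightarrow> stops_by (U1 p (signal1 a b h) (signal2 c)) 3"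
      "\<And>h c. c \<in> {1, revealing h} \<Longrightarrow> stops_by (U2 p (signal1 a b h) (signal2 c)) 3"
    and correct: "\<And>h c. c \<in> {1, revealing h} \<Longrightarrow> final_decision p (signal1 a b h) (signal2 c) = h"
  shows "cost K 1 J p h (signal1 a b h) (signal2 1) \<ge> (if first_rule p 1 = None then K + 1 else 2)"
    and "cost K 1 J p h (signal1 a b h) (signal2 (revealing h)) \<ge>
      (if first_rule p (revealing h) = None then K else if first_rule p (revealing h) = first_rule p 1 then 2 else 1)"
proof -
  have Jh: "J h h = 0" using J by (cases h) auto
  obtain h' where "h' \<noteq> h" by (metis zero_neq_one)
  \<comment> \<open>The comparison path has the same two coin tosses but the third observation of
    the other hypothesis \<open>h'\<close>.\<close>
  note * = final_decision_differs_imp[of "signal1 a b h" "signal1 a b h'" p "signal2 1"]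
  have wait: "U1 p (signal1 a b h) (signal2 1) 1 = None" "U1 p (signal1 a b h) (signal2 1) 2 = None"
    "U2 p (signal1 a b h) (signal2 1) 1 \<noteq> None \<or> U2 p (signal1 a b h) (signal2 1) 2 \<noteq> None"
    using * stops correct \<open>h' \<noteq> h\<close> by (auto simp: signal1_def)
  show "cost K 1 J p h (signal1 a b h) (signal2 1) \<ge> (if first_rule p 1 = None then K + 1 else 2)"
    using wait stops[of 1 h] correct[of 1 h] Jh
    by (auto simp: cost_def Let_def stop_time_3 U2_numeral(1) first_rule_def signal2_def)
  \<comment> \<open>Observer 1's first decision uses only its own first observation, so the wait at
    time 1 carries over from the uninformative signal.\<close>
  have "U1 p (signal1 a b h) (signal2 (revealing h)) 1 = None"
    using wait by (simp add: U1_numeral)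
  moreover have "U1 p (signal1 a b h) (signal2 (revealing h)) 2 = None"
    if "first_rule p (revealing h) = first_rule p 1"
    using wait that by (simp add: U1_numeral U2_numeral first_rule_def signal2_def)
  ultimately show "cost K 1 J p h (signal1 a b h) (signal2 (revealing h)) \<ge>
      (if first_rule p (revealing h) = None then K else if first_rule p (revealing h) = first_rule p 1 then 2 else 1)"
    using stops[of "revealing h" h] correct[of "revealing h" h] Jh K
    by (auto simp: cost_def Let_def stop_time_3 U2_numeral(1) first_rule_def signal2_def)
qed

section \<open>Relay pairs and two-threshold rules\<close>

text \<open>Every minimizer exhibited below is of this form: \<open>d\<close> announces observer 2's first
  observation, and \<open>e\<close> is how observer 1 decodes the announcement.\<close>

definition relay :: "(nat \<Rightarrow> decision) \<Rightarrow> (decision \<Rightarrow> decision) \<Rightarrow> nat policy \<times> nat policy"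
  where "relay d e =
    (\<lambda>t y u1 u2. if t = 1 then None else if t = 2 then e (last u2) else Some (of_bool (last y = 1)),
     \<lambda>t y u1 u2. if t = 1 then d (last y) else Some 0)"

lemma relay_stops:
  "stops_by (U1 (relay d e) y1 y2) 3" "stops_by (U2 (relay d e) y1 y2) 3"
  by (auto simp: stops_by_3_iff U1_numeral U2_numeral relay_def)

text \<open>If both observers stop at time 2, the tie gives the final decision to observer 2, whose
  second decision is always 0; hence the value 0 when \<open>d\<close> is blank, whatever
  \<open>u\<close> is.\<close>

lemma relay_final_decision:
  "final_decision (relay d e) y1 y2 =
    (case e (d (y2 1)) of None \<Rightarrow> of_bool (y1 3 = 1) | Some u \<Rightarrow> if d (y2 1) = None then 0 else u)"
  using relay_stops[of d e y1 y2]
  by (auto simp: final_decision_def stop_time_3 U1_numeral U2_numeral Let_def relay_def split: option.split)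

lemma relay_cost:
  "cost K k J (relay d e) h y1 y2 =
    (if d (y2 1) = None then K else 0)
    + k * ((if e (d (y2 1)) = None then 2 else 1) - (if d (y2 1) = None then 1 else 0))
    + J (final_decision (relay d e) y1 y2) h"
  using relay_stops[of d e y1 y2]
  by (auto simp: cost_def stop_time_3 U1_numeral U2_numeral Let_def relay_def)

lemma relay_U2: "U2 (relay d e) y1 y2 1 = d (y2 1)"
  by (simp add: U2_numeral relay_def)

lemma lowest_costI:
  assumes "p \<in> P" "C p = v" "\<And>p'. p' \<in> P \<Longrightarrow> v \<le> C p'"
  shows "lowest_cost C P v"
  using assms unfolding lowest_cost_def is_arg_min_def by (metis not_less)

text \<open>In the instance only the beliefs 0, 1/2 and 1 occur. A two-threshold rule never
  continues at 0 or 1, and if it stops at 1/2, monotonicity makes that decision agree with the one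
  at an extreme belief. The free \<open>u\<close> absorbs a tie \<open>\<alpha> = \<beta>\<close>
  located at 0 or 1.\<close>

lemma two_threshold_cases:
  assumes "two_threshold \<rho>"
  shows "\<rho> 0 = Some 1 \<and> \<rho> 1 = Some 0
    \<or> (\<exists>u. \<rho> 0 = Some u \<and> \<rho> (1/2) = Some 0 \<and> \<rho> 1 = Some 0)
    \<or> (\<exists>u. \<rho> 0 = Some 1 \<and> \<rho> (1/2) = Some 1 \<and> \<rho> 1 = Some u)"
proof -
  obtain \<alpha> \<beta> where ab: "0 \<le> \<alpha>" "\<alpha> \<le> \<beta>" "\<beta> \<le> 1"
    and strict: "\<And>\<pi>. \<pi> \<in> {0..1} \<Longrightarrow> \<alpha> < \<beta> \<Longrightarrow>
        \<rho> \<pi> = (if \<pi> \<le> \<alpha> then Some 1 else if \<pi> < \<beta> then None else Some 0)"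
    and equal: "\<And>\<pi>. \<pi> \<in> {0..1} \<Longrightarrow> \<alpha> = \<beta> \<Longrightarrow> \<pi> < \<alpha> \<Longrightarrow> \<rho> \<pi> = Some 1"
      "\<And>\<pi>. \<pi> \<in> {0..1} \<Longrightarrow> \<alpha> = \<beta> \<Longrightarrow> \<pi> > \<alpha> \<Longrightarrow> \<rho> \<pi> = Some 0"
      "\<And>\<pi>. \<pi> \<in> {0..1} \<Longrightarrow> \<alpha> = \<beta> \<Longrightarrow> \<pi> = \<alpha> \<Longrightarrow> \<rho> \<pi> \<in> {Some 0, Some 1}"
    using assms unfolding two_threshold_def by blast
  consider "\<alpha> < \<beta>" | "\<alpha> = \<beta>" "\<alpha> = 0" | "\<alpha> = \<beta>" "\<alpha> = 1" | "\<alpha> = \<beta>" "0 < \<alpha>" "\<alpha> < 1"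
    using ab by force
  then show ?thesis
  proof cases
    case 1
    then show ?thesis using ab by (simp add: strict)
  next
    case 2
    then show ?thesis using equal(3)[of 0] equal(2)[of "1/2"] equal(2)[of 1] by auto
  next
    case 3
    then show ?thesis using equal(1)[of 0] equal(1)[of "1/2"] equal(3)[of 1] by auto
  next
    case 4
    then show ?thesis using equal(1)[of 0] equal(2)[of 1] by auto
  qed
qed

section \<open>Path probabilities\<close>

context prob_space begin

text \<open>On the space, \<open>f\<close> is a finite combination of indicators of level sets of
  \<open>X\<close>, so measurability of those sets suffices.\<close>

lemma expectation_finite_range:
  fixes G :: "'b \<Rightarrow> real"
  assumes S: "finite S" "\<And>w. w \<in> space M \<Longrightarrow> X w \<in> S"
    and ev: "\<And>x. x \<in> S \<Longrightarrow> {w \<in> space M. X w = x} \<in> events"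
    and f: "\<And>w. w \<in> space M \<Longrightarrow> f w = G (X w)"
  shows "expectation f = (\<Sum>x\<in>S. prob {w \<in> space M. X w = x} * G x)"
proof -
  have "expectation f = expectation (\<lambda>w. \<Sum>x\<in>S. indicator {w \<in> space M. X w = x} w * G x)"
  proof (rule Bochner_Integration.integral_cong[OF refl])
    fix w assume w: "w \<in> space M"
    have "(\<Sum>x\<in>S. indicator {w \<in> space M. X w = x} w * G x) = (\<Sum>x\<in>S. if x = X w then G x else 0)"
      using w by (intro sum.cong) auto
    then show "f w = (\<Sum>x\<in>S. indicator {w \<in> space M. X w = x} w * G x)"
      using S w f by simp
  qed
  also have "\<dots> = (\<Sum>x\<in>S. expectation (\<lambda>w. indicator {w \<in> space M. X w = x} w * G x))"
    using ev by (intro Bochner_Integration.integral_sum integrable_mult_left integrable_real_indicator)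
      (auto simp: emeasure_eq_measure)
  also have "\<dots> = (\<Sum>x\<in>S. prob {w \<in> space M. X w = x} * G x)"
    using ev by (intro sum.cong) (auto simp: Int_absorb2 sets.sets_into_space)
  finally show ?thesis .
qed

end

context two_observer_detection begin

lemma H_event: "{w \<in> space M. H w = h} \<in> events"
  using measurable_sets[OF H_measurable, of "{h}"] by (simp add: vimage_def Int_def conj_commute)

lemma Y1_event: "t \<in> {1..T} \<Longrightarrow> {w \<in> space M. Y1 t w = y} \<in> events"
  using measurable_sets[OF Y1_measurable, of t "{y}"] by (simp add: vimage_def Int_def conj_commute)

lemma Y2_event: "t \<in> {1..T} \<Longrightarrow> {w \<in> space M. Y2 t w = y} \<in> events"
  using measurable_sets[OF Y2_measurable, of t "{y}"] by (simp add: vimage_def Int_def conj_commute)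

lemma path_event:
  "{w \<in> space M. H w = h \<and> (\<forall>t\<in>{1..T}. Y1 t w = a t) \<and> (\<forall>t\<in>{1..T}. Y2 t w = b t)} \<in> events"
  by (intro sets.sets_Collect_conj sets.sets_Collect_finite_All' sets.sets_Collect_finite_All H_event Y1_event Y2_event) auto

text \<open>Under the measure conditioned on \<open>H = h\<close>, independence of the two
  observation vectors splits a path event into two factors, and independence over time splits each
  factor into a product.\<close>

lemma path_prob:
  assumes T: "1 \<le> T" and pos: "prob {w \<in> space M. H w = h} > 0"
  shows "prob {w \<in> space M. H w = h \<and> (\<forall>t\<in>{1..T}. Y1 t w = a t) \<and> (\<forall>t\<in>{1..T}. Y2 t w = b t)} =
    prob {w \<in> space M. H w = h} * (\<Prod>t\<in>{1..T}. \<P>(w in M. Y1 t w = a t \<bar> H w = h))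
      * (\<Prod>t\<in>{1..T}. \<P>(w in M. Y2 t w = b t \<bar> H w = h))"
proof -
  define A where "A = {w \<in> space M. H w = h}"
  define N where "N = uniform_measure M A"
  have A0: "emeasure M A \<noteq> 0" "emeasure M A \<noteq> \<infinity>"
    using pos by (auto simp: A_def emeasure_eq_measure)
  interpret N: prob_space N
    unfolding N_def by (rule prob_space_uniform_measure[OF A0])
  have [simp]: "space N = space M" "sets N = sets M" by (simp_all add: N_def)
  have N_prob: "N.prob {w \<in> space M. P w} = \<P>(w in M. P w \<bar> H w = h)"
    if "{w \<in> space M. P w} \<in> events" for P
    unfolding N_def cond_prob_def
    by (subst measure_uniform_measure[OF A0 that], unfold A_def)
      (intro arg_cong2[where f = "(/)"] arg_cong[where f = prob]; auto)
  let ?E1 = "{w \<in> space M. \<forall>t\<in>{1..T}. Y1 t w = a t}" and ?E2 = "{w \<in> space M. \<forall>t\<in>{1..T}. Y2 t w = b t}"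
  have ev1: "?E1 \<in> events" and ev2: "?E2 \<in> events"
    by (intro sets.sets_Collect_finite_All' sets.sets_Collect_finite_All Y1_event Y2_event; simp)+
  have ind: "N.indep_vars (\<lambda>_. count_space UNIV) Y1 {1..T}" "N.indep_vars (\<lambda>_. count_space UNIV) Y2 {1..T}"
    unfolding N_def A_def by (rule Y1_cond_indep[OF pos] Y2_cond_indep[OF pos])+
  \<comment> \<open>\<open>1 \<le> T\<close> keeps the index set nonempty; an empty intersection
    would be the whole type instead of the space.\<close>
  have "N.prob ?E1 = N.prob (\<Inter>t\<in>{1..T}. Y1 t -` {a t} \<inter> space N)"
    using T by (intro arg_cong[where f = N.prob]) auto
  also have "\<dots> = (\<Prod>t\<in>{1..T}. N.prob (Y1 t -` {a t} \<inter> space N))"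
    using T by (intro N.indep_varsD_finite[OF ind(1)]) auto
  also have "\<dots> = (\<Prod>t\<in>{1..T}. N.prob {w \<in> space M. Y1 t w = a t})"
    by (intro prod.cong arg_cong[where f = N.prob]) auto
  also have "\<dots> = (\<Prod>t\<in>{1..T}. \<P>(w in M. Y1 t w = a t \<bar> H w = h))"
    by (intro prod.cong refl N_prob Y1_event)
  finally have p1: "N.prob ?E1 = \<dots>" .
  have "N.prob ?E2 = N.prob (\<Inter>t\<in>{1..T}. Y2 t -` {b t} \<inter> space N)"
    using T by (intro arg_cong[where f = N.prob]) auto
  also have "\<dots> = (\<Prod>t\<in>{1..T}. N.prob (Y2 t -` {b t} \<inter> space N))"
    using T by (intro N.indep_varsD_finite[OF ind(2)]) auto
  also have "\<dots> = (\<Prod>t\<in>{1..T}. N.prob {w \<in> space M. Y2 t w = b t})"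
    by (intro prod.cong arg_cong[where f = N.prob]) auto
  also have "\<dots> = (\<Prod>t\<in>{1..T}. \<P>(w in M. Y2 t w = b t \<bar> H w = h))"
    by (intro prod.cong refl N_prob Y2_event)
  finally have p2: "N.prob ?E2 = \<dots>" .
  have indep: "N.indep_var
      (PiM {1..T} (\<lambda>_. count_space UNIV)) (\<lambda>w. \<lambda>t\<in>{1..T}. Y1 t w)
      (PiM {1..T} (\<lambda>_. count_space UNIV)) (\<lambda>w. \<lambda>t\<in>{1..T}. Y2 t w)"
    unfolding N_def A_def by (rule Y1_Y2_cond_indep[OF pos])
  \<comment> \<open>Independence of the observers is given for whole vectors, so each path event is
    written as the preimage of a one-point product set.\<close>
  let ?XA = "PiE {1..T} (\<lambda>t. {a t})" and ?XB = "PiE {1..T} (\<lambda>t. {b t})"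
  have XA: "?XA \<in> sets (PiM {1..T} (\<lambda>_. count_space UNIV))"
    and XB: "?XB \<in> sets (PiM {1..T} (\<lambda>_. count_space UNIV))"
    by (intro sets_PiM_I_finite; simp)+
  have e1: "(\<lambda>w. \<lambda>t\<in>{1..T}. Y1 t w) -` ?XA \<inter> space N = ?E1"
    and e2: "(\<lambda>w. \<lambda>t\<in>{1..T}. Y2 t w) -` ?XB \<inter> space N = ?E2"
    by (auto simp: PiE_iff)
  have "prob {w \<in> space M. H w = h \<and> (\<forall>t\<in>{1..T}. Y1 t w = a t) \<and> (\<forall>t\<in>{1..T}. Y2 t w = b t)} =
      prob (A \<inter> (?E1 \<inter> ?E2))"
    unfolding A_def by (intro arg_cong[where f = prob]) auto
  also have "\<dots> = prob A * N.prob (?E1 \<inter> ?E2)"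
    using pos ev1 ev2 by (subst N_def, subst measure_uniform_measure[OF A0]) (auto simp: A_def)
  also have "?E1 \<inter> ?E2 =
      (\<lambda>w. (\<lambda>t\<in>{1..T}. Y1 t w, \<lambda>t\<in>{1..T}. Y2 t w)) -` (?XA \<times> ?XB) \<inter> space N"
    using e1 e2 by auto
  also have "N.prob \<dots> = N.prob ?E1 * N.prob ?E2"
    using N.indep_varD[OF indep XA XB] unfolding e1 e2 .
  finally show ?thesis
    unfolding p1 p2 A_def by simp
qed

end

lemma UNIV_bit: "(UNIV :: bit set) = {0, 1}"
  using bit.exhaust by auto

lemma finite_bit: "finite (UNIV :: bit set)"
  by (simp add: UNIV_bit)

lemma sum_SIGMA:
  assumes "finite A" "\<And>a. a \<in> A \<Longrightarrow> finite (B a)"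
  shows "sum g (Sigma A B) = (\<Sum>a\<in>A. \<Sum>b\<in>B a. g (a, b))"
  using assms by (simp add: sum.Sigma)

lemma prod_1_3: "(\<Prod>t\<in>{1..3::nat}. f t) = f 1 * f 2 * (f 3 :: 'a::comm_monoid_mult)"
  unfolding atLeastAtMost_1_3 by (simp add: mult.assoc)

section \<open>The instance\<close>

text \<open>Packages the hypotheses of the final theorem; \<open>K_gt_k\<close> at
  \<open>k = 1\<close> supplies \<open>1 < K\<close>.\<close>

locale detection_instance = two_observer_detection M H Y1 Y2 3 K 1 J
  for M :: "'w measure" and H :: "'w \<Rightarrow> bit" and Y1 Y2 :: "nat \<Rightarrow> 'w \<Rightarrow> nat"
    and K :: real and J :: "bit \<Rightarrow> bit \<Rightarrow> real" +
  fixes q r :: "nat \<Rightarrow> real"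
  assumes K_less_2: "K < 2"
    and prior: "prob {w \<in> space M. H w = 0} = 1/2" "prob {w \<in> space M. H w = 1} = 1/2"
    and range1: "\<And>t w. t \<in> {1..3} \<Longrightarrow> w \<in> space M \<Longrightarrow> Y1 t w \<in> {0, 1}"
    and range2: "\<And>t w. t \<in> {1..3} \<Longrightarrow> w \<in> space M \<Longrightarrow> Y2 t w \<in> {0, 1, 2}"
    and obs1: "\<And>t. t \<in> {1..3} \<Longrightarrow>
        \<P>(w in M. Y1 t w = 0 \<bar> H w = 0) = q t \<and> \<P>(w in M. Y1 t w = 1 \<bar> H w = 1) = q t \<and>
        \<P>(w in M. Y1 t w = 1 \<bar> H w = 0) = 1 - q t \<and> \<P>(w in M. Y1 t w = 0 \<bar> H w = 1) = 1 - q t"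
    and q: "q 1 = 1/2" "q 2 = 1/2" "q 3 = 1"
    and obs2: "\<And>t. t \<in> {1..3} \<Longrightarrow>
        \<P>(w in M. Y2 t w = 0 \<bar> H w = 0) = r t \<and> \<P>(w in M. Y2 t w = 1 \<bar> H w = 0) = 1 - r t \<and>
        \<P>(w in M. Y2 t w = 2 \<bar> H w = 0) = 0 \<and>
        \<P>(w in M. Y2 t w = 0 \<bar> H w = 1) = 0 \<and> \<P>(w in M. Y2 t w = 1 \<bar> H w = 1) = 1 - r t \<and>
        \<P>(w in M. Y2 t w = 2 \<bar> H w = 1) = r t"
    and r: "0 < r 1" "r 1 < 1" "r 2 = 0" "r 3 = 0"
    and error_costs: "\<And>p. p \<in> policy_pairs M Y1 Y2 3 \<Longrightarrow> error_prob M H Y1 Y2 p > 0 \<Longrightarrow>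
        expected_cost M H Y1 Y2 K 1 J p > 2"
begin

section \<open>Distribution of the observed paths\<close>

lemma prior_half: "prob {w \<in> space M. H w = h} = 1/2"
  using prior by (cases h) auto

text \<open>Restricting to the horizon leaves finitely many possible values, so every expectation
  becomes a finite sum.\<close>

definition outcome :: "'w \<Rightarrow> bit \<times> (nat \<Rightarrow> nat) \<times> (nat \<Rightarrow> nat)"
  where "outcome w = (H w, (\<lambda>t\<in>{1..3}. Y1 t w), (\<lambda>t\<in>{1..3}. Y2 t w))"

definition outcomes :: "(bit \<times> (nat \<Rightarrow> nat) \<times> (nat \<Rightarrow> nat)) set"
  where "outcomes = UNIV \<times> ({1..3} \<rightarrow>\<^sub>E {0, 1}) \<times> ({1..3} \<rightarrow>\<^sub>E {0, 1, 2})"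

lemma finite_outcomes: "finite outcomes"
  unfolding outcomes_def by (intro finite_cartesian_product finite_PiE) (auto simp: UNIV_bit)

lemma outcome_in: "w \<in> space M \<Longrightarrow> outcome w \<in> outcomes"
  using range1 range2 unfolding outcome_def outcomes_def by (auto intro!: PiE_I)

lemma outcome_eq_iff:
  assumes "y1 \<in> extensional {1..3}" "y2 \<in> extensional {1..3}"
  shows "outcome w = (h, y1, y2) \<longleftrightarrow>
    H w = h \<and> (\<forall>t\<in>{1..3}. Y1 t w = y1 t) \<and> (\<forall>t\<in>{1..3}. Y2 t w = y2 t)"
proof -
  have "(\<lambda>t\<in>{1..3}. Y t w) = y \<longleftrightarrow> (\<forall>t\<in>{1..3}. Y t w = y t)"
    if "y \<in> extensional {1..3}" for Y :: "nat \<Rightarrow> 'w \<Rightarrow> nat" and y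
  proof
    assume "(\<lambda>t\<in>{1..3}. Y t w) = y"
    then show "\<forall>t\<in>{1..3}. Y t w = y t" by auto
  next
    assume "\<forall>t\<in>{1..3}. Y t w = y t"
    then show "(\<lambda>t\<in>{1..3}. Y t w) = y"
      by (intro extensionalityI[OF restrict_extensional that]) simp
  qed
  with assms show ?thesis by (simp add: outcome_def)
qed

lemma outcome_event:
  assumes "x \<in> outcomes"
  shows "{w \<in> space M. outcome w = x} \<in> events"
proof (cases x)
  case (fields h y1 y2)
  with assms have "y1 \<in> extensional {1..3}" "y2 \<in> extensional {1..3}"
    by (auto simp: outcomes_def PiE_iff)
  from outcome_eq_iff[OF this] path_event[of h y1 y2] show ?thesis
    by (simp add: fields)
qed

text \<open>The prior and the two fair tosses give the factor 1/8. Since \<open>q 3 = 1\<close>,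
  observer 1's third observation is forced by \<open>h\<close>, and since
  \<open>r 2 = r 3 = 0\<close>, observer 2's later observations are forced to be 1.\<close>

lemma outcome_prob:
  assumes "y1 \<in> {1..3} \<rightarrow>\<^sub>E {0, 1}" "y2 \<in> {1..3} \<rightarrow>\<^sub>E {0, 1, 2}"
  shows "prob {w \<in> space M. outcome w = (h, y1, y2)} =
    (if y1 3 = (if h = 0 then 0 else 1) \<and> y2 2 = 1 \<and> y2 3 = 1
     then (if y2 1 = revealing h then r 1 else if y2 1 = 1 then 1 - r 1 else 0) / 8 else 0)"
proof -
  have P1: "\<P>(w in M. Y1 t w = y \<bar> H w = h) = (if y = (if h = 0 then 0 else 1) then q t else 1 - q t)"
    if "t \<in> {1..3}" "y \<in> {0, 1}" for t y
    using obs1[OF that(1)] that(2) by (cases h) auto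
  have P2: "\<P>(w in M. Y2 t w = y \<bar> H w = h) = (if y = revealing h then r t else if y = 1 then 1 - r t else 0)"
    if "t \<in> {1..3}" "y \<in> {0, 1, 2}" for t y
    using obs2[OF that(1)] that(2) by (cases h) (auto simp: revealing_def)
  have mem: "y1 t \<in> {0, 1}" "y2 t \<in> {0, 1, 2}" if "t \<in> {1..3}" for t
    using assms that by blast+
  have "prob {w \<in> space M. outcome w = (h, y1, y2)} =
      prob {w \<in> space M. H w = h} * (\<Prod>t\<in>{1..3}. \<P>(w in M. Y1 t w = y1 t \<bar> H w = h))
      * (\<Prod>t\<in>{1..3}. \<P>(w in M. Y2 t w = y2 t \<bar> H w = h))"
    using assms by (subst path_prob[symmetric]) (auto simp: outcome_eq_iff PiE_iff prior_half)
  also have "\<dots> = 1/2 * (\<Prod>t\<in>{1..3}. if y1 t = (if h = 0 then 0 else 1) then q t else 1 - q t)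
      * (\<Prod>t\<in>{1..3}. if y2 t = revealing h then r t else if y2 t = 1 then 1 - r t else 0)"
    using mem by (intro arg_cong2[where f = "(*)"] prod.cong refl) (simp_all only: P1 P2 prior_half)
  also have "\<dots> = (if y1 3 = (if h = 0 then 0 else 1) \<and> y2 2 = 1 \<and> y2 3 = 1
     then (if y2 1 = revealing h then r 1 else if y2 1 = 1 then 1 - r 1 else 0) / 8 else 0)"
  proof -
    have "(if y1 t = z then q t else 1 - q t) = 1/2" if "t = 1 \<or> t = 2" for t z
      using that q by auto
    then have A: "(if y1 1 = z then q 1 else 1 - q 1) = 1/2" "(if y1 2 = z then q 2 else 1 - q 2) = 1/2" for z
      by blast+
    have "(if y2 t = revealing h then r t else if y2 t = 1 then 1 - r t else 0) = of_bool (y2 t = 1)"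
      if "t = 2 \<or> t = 3" for t
      using that r by (auto simp: revealing_def)
    then have B: "(if y2 2 = revealing h then r 2 else if y2 2 = 1 then 1 - r 2 else 0) = of_bool (y2 2 = 1)"
      "(if y2 3 = revealing h then r 3 else if y2 3 = 1 then 1 - r 3 else 0) = of_bool (y2 3 = 1)"
      by blast+
    show ?thesis
      unfolding prod_1_3 A B q(3) by simp
  qed
  finally show ?thesis .
qed

lemma signal_in:
  assumes "a \<in> {0, 1}" "b \<in> {0, 1}" "c \<in> {1, revealing h}"
  shows "signal1 a b h \<in> {1..3} \<rightarrow>\<^sub>E {0, 1}" "signal2 c \<in> {1..3} \<rightarrow>\<^sub>E {0, 1, 2}"
  using assms by (cases h; auto simp: signal1_def signal2_def revealing_def PiE_iff)+

lemma signal_outcome_in: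
  assumes "a \<in> {0, 1}" "b \<in> {0, 1}" "c \<in> {1, revealing h}"
  shows "(h, signal1 a b h, signal2 c) \<in> outcomes"
  using signal_in[OF assms] by (simp add: outcomes_def)

lemma signal_prob:
  assumes "a \<in> {0, 1}" "b \<in> {0, 1}" "c \<in> {1, revealing h}"
  shows "prob {w \<in> space M. outcome w = (h, signal1 a b h, signal2 c)} = (if c = 1 then 1 - r 1 else r 1) / 8"
  using assms(3) unfolding outcome_prob[OF signal_in[OF assms]]
  by (auto simp: signal1_def signal2_def revealing_def)

text \<open>Positive probability yields an actual sample point, through which conditions imposed on
  \<open>space M\<close> (stopping in time, following a rule) pass to the abstract signals.\<close>

lemma signal_occurs:
  assumes "a \<in> {0, 1}" "b \<in> {0, 1}" "c \<in> {1, revealing h}"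
  obtains w where "w \<in> space M" "outcome w = (h, signal1 a b h, signal2 c)"
proof -
  have "prob {w \<in> space M. outcome w = (h, signal1 a b h, signal2 c)} > 0"
    using r by (simp add: signal_prob[OF assms])
  then have "{w \<in> space M. outcome w = (h, signal1 a b h, signal2 c)} \<noteq> {}"
    by (metis measure_empty less_irrefl)
  then show ?thesis using that by blast
qed

lemma expectation_signals:
  assumes f: "\<And>w. w \<in> space M \<Longrightarrow> f w = G (outcome w)"
  shows "expectation f = (\<Sum>h\<in>UNIV. \<Sum>a\<in>{0, 1}. \<Sum>b\<in>{0, 1}.
    ((1 - r 1) * G (h, signal1 a b h, signal2 1) + r 1 * G (h, signal1 a b h, signal2 (revealing h))) / 8)"
proof -
  define I where "I = (SIGMA h:UNIV. SIGMA a:{0, 1::nat}. SIGMA b:{0, 1::nat}. {1, revealing h})"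
  define sg where "sg = (\<lambda>(h, a, b, c). (h, signal1 a b h, signal2 c))"
  have inj: "inj_on sg I"
  proof (rule inj_onI)
    fix x y assume "sg x = sg y"
    moreover obtain h a b c h' a' b' c' where "x = (h, a, b, c)" "y = (h', a', b', c')"
      by (metis prod_cases4)
    ultimately have "h = h'" "signal1 a b h = signal1 a' b' h'" "signal2 c = signal2 c'"
      by (auto simp: sg_def)
    from this(1) fun_cong[OF this(2), of 1] fun_cong[OF this(2), of 2] fun_cong[OF this(3), of 1]
    show "x = y" using \<open>x = _\<close> \<open>y = _\<close> by (simp add: signal1_def signal2_def)
  qed
  have sub: "sg ` I \<subseteq> outcomes"
    using signal_outcome_in by (auto simp: I_def sg_def)
  \<comment> \<open>A non-null outcome has all its forced coordinates right, and extensionality then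
    identifies it with a signal.\<close>
  have zero: "prob {w \<in> space M. outcome w = x} = 0" if x: "x \<in> outcomes - sg ` I" for x
  proof (rule ccontr)
    assume nz: "prob {w \<in> space M. outcome w = x} \<noteq> 0"
    obtain h y1 y2 where x_eq: "x = (h, y1, y2)" by (cases x)
    with x have y: "y1 \<in> {1..3} \<rightarrow>\<^sub>E {0, 1}" "y2 \<in> {1..3} \<rightarrow>\<^sub>E {0, 1, 2}"
      by (auto simp: outcomes_def)
    from nz have c: "y1 3 = (if h = 0 then 0 else 1)" "y2 2 = 1" "y2 3 = 1" "y2 1 \<in> {1, revealing h}"
      unfolding x_eq outcome_prob[OF y] by (auto split: if_splits)
    have y1: "y1 = signal1 (y1 1) (y1 2) h"
    proof (rule extensionalityI[of _ "{1..3}"])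
      show "y1 t = signal1 (y1 1) (y1 2) h t" if "t \<in> {1..3}" for t
        using that c(1) unfolding atLeastAtMost_1_3 by (auto simp: signal1_def)
    qed (use y in \<open>auto simp: PiE_iff signal1_def\<close>)
    have y2: "y2 = signal2 (y2 1)"
    proof (rule extensionalityI[of _ "{1..3}"])
      show "y2 t = signal2 (y2 1) t" if "t \<in> {1..3}" for t
        using that c(2,3) unfolding atLeastAtMost_1_3 by (auto simp: signal2_def)
    qed (use y in \<open>auto simp: PiE_iff signal2_def\<close>)
    have "y1 1 \<in> {0, 1}" "y1 2 \<in> {0, 1}"
      using PiE_mem[OF y(1), of 1] PiE_mem[OF y(1), of 2] by simp_all
    then have "(h, y1 1, y1 2, y2 1) \<in> I"
      using c(4) by (auto simp: I_def)
    moreover have "sg (h, y1 1, y1 2, y2 1) = x"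
      using y1 y2 by (simp add: sg_def x_eq)
    ultimately show False using x by blast
  qed
  have "expectation f = (\<Sum>x\<in>outcomes. prob {w \<in> space M. outcome w = x} * G x)"
    using finite_outcomes outcome_in outcome_event f by (rule expectation_finite_range)
  also have "\<dots> = (\<Sum>x\<in>sg ` I. prob {w \<in> space M. outcome w = x} * G x)"
    using finite_outcomes sub zero by (intro sum.mono_neutral_right) auto
  also have "\<dots> = (\<Sum>x\<in>I. prob {w \<in> space M. outcome w = sg x} * G (sg x))"
    using inj by (simp add: sum.reindex)
  also have "\<dots> = (\<Sum>h\<in>UNIV. \<Sum>a\<in>{0, 1}. \<Sum>b\<in>{0, 1}. \<Sum>c\<in>{1, revealing h}.
      prob {w \<in> space M. outcome w = (h, signal1 a b h, signal2 c)} * G (h, signal1 a b h, signal2 c))"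
    by (simp only: I_def sg_def sum_SIGMA finite_bit finite_SigmaI finite.intros prod.case)
  also have "\<dots> = (\<Sum>h\<in>UNIV. \<Sum>a\<in>{0, 1}. \<Sum>b\<in>{0, 1}.
    ((1 - r 1) * G (h, signal1 a b h, signal2 1) + r 1 * G (h, signal1 a b h, signal2 (revealing h))) / 8)"
  proof (intro sum.cong refl)
    fix h a b assume ab: "a \<in> {0, 1::nat}" "b \<in> {0, 1::nat}"
    let ?g = "\<lambda>c. G (h, signal1 a b h, signal2 c)"
    let ?pr = "\<lambda>c. prob {w \<in> space M. outcome w = (h, signal1 a b h, signal2 c)}"
    have ne: "revealing h \<noteq> 1" by (simp add: revealing_def)
    then have pr: "?pr 1 = (1 - r 1) / 8" "?pr (revealing h) = r 1 / 8"
      by (subst signal_prob[OF ab]; simp)+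
    have "(\<Sum>c\<in>{1, revealing h}. ?pr c * ?g c) = ?pr 1 * ?g 1 + ?pr (revealing h) * ?g (revealing h)"
      using ne by (subst sum.insert) auto
    also have "\<dots> = ((1 - r 1) * ?g 1 + r 1 * ?g (revealing h)) / 8"
      unfolding pr by (simp add: add_divide_distrib)
    finally show "(\<Sum>c\<in>{1, revealing h}. ?pr c * ?g c) = ((1 - r 1) * ?g 1 + r 1 * ?g (revealing h)) / 8" .
  qed
  finally show ?thesis .
qed

text \<open>Bayes' formula with equal priors, which cancel; \<open>0 < r 1 < 1\<close> keeps all
  three denominators nonzero.\<close>

lemma belief_eq: "belief M H Y2 0 = 1" "belief M H Y2 1 = 1/2" "belief M H Y2 2 = 0"
proof -
  have joint: "prob {w \<in> space M. H w = h \<and> Y2 1 w = y} = \<P>(w in M. Y2 1 w = y \<bar> H w = h) / 2" for h y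
    using prior_half[of h] by (simp add: cond_prob_def conj_commute)
  have ev: "{w \<in> space M. H w = h \<and> Y2 1 w = y} \<in> events" for h y
    by (intro sets.sets_Collect_conj H_event Y2_event) simp
  have total: "prob {w \<in> space M. Y2 1 w = y} =
      prob {w \<in> space M. H w = 0 \<and> Y2 1 w = y} + prob {w \<in> space M. H w = 1 \<and> Y2 1 w = y}" for y
    by (subst finite_measure_Union[OF ev ev, symmetric]) (auto intro!: arg_cong[where f = prob])
  have "belief M H Y2 y = \<P>(w in M. Y2 1 w = y \<bar> H w = 0) /
      (\<P>(w in M. Y2 1 w = y \<bar> H w = 0) + \<P>(w in M. Y2 1 w = y \<bar> H w = 1))" for y
    unfolding belief_def cond_prob_def[of M "\<lambda>w. H w = 0"] total joint by simp
  then show "belief M H Y2 0 = 1" "belief M H Y2 1 = 1/2" "belief M H Y2 2 = 0"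
    using obs2[of 1] r by simp_all
qed

section \<open>Pairs of policies evaluated on the signals\<close>

context
  fixes p assumes p: "p \<in> policy_pairs M Y1 Y2 3"
begin

lemma policy_stops:
  assumes "w \<in> space M"
  shows "stops_by (U1 p (\<lambda>t. Y1 t w) (\<lambda>t. Y2 t w)) 3" "stops_by (U2 p (\<lambda>t. Y1 t w) (\<lambda>t. Y2 t w)) 3"
  using p assms by (auto simp: policy_pairs_def)

lemma final_decision_outcome:
  assumes "w \<in> space M" "outcome w = (h, y1, y2)"
  shows "final_decision p (\<lambda>t. Y1 t w) (\<lambda>t. Y2 t w) = final_decision p y1 y2"
  using assms policy_stops[OF assms(1)] by (intro final_decision_cong_3) (auto simp: outcome_def)

lemma expected_cost_signals:
  "expected_cost M H Y1 Y2 K 1 J p = (\<Sum>h\<in>UNIV. \<Sum>a\<in>{0, 1}. \<Sum>b\<in>{0, 1}.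
    ((1 - r 1) * cost K 1 J p h (signal1 a b h) (signal2 1)
     + r 1 * cost K 1 J p h (signal1 a b h) (signal2 (revealing h))) / 8)"
proof -
  have "cost K 1 J p (H w) (\<lambda>t. Y1 t w) (\<lambda>t. Y2 t w) = (case outcome w of (h, y1, y2) \<Rightarrow> cost K 1 J p h y1 y2)"
    if "w \<in> space M" for w
    using policy_stops[OF that] unfolding outcome_def prod.case by (intro cost_cong_3) auto
  then show ?thesis
    unfolding expected_cost_def
    by (subst expectation_signals[where G = "\<lambda>(h, y1, y2). cost K 1 J p h y1 y2"]) simp_all
qed

lemma signal_stops:
  assumes "a \<in> {0, 1}" "b \<in> {0, 1}" "c \<in> {1, revealing h}"
  shows "stops_by (U1 p (signal1 a b h) (signal2 c)) 3" "stops_by (U2 p (signal1 a b h) (signal2 c)) 3"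
proof -
  obtain w where w: "w \<in> space M" "outcome w = (h, signal1 a b h, signal2 c)"
    using signal_occurs[OF assms] .
  then have "Y1 t w = signal1 a b h t" "Y2 t w = signal2 c t" if "t \<in> {1..3}" for t
    using that by (auto simp: outcome_def dest!: fun_cong[where x = t])
  then show "stops_by (U1 p (signal1 a b h) (signal2 c)) 3" "stops_by (U2 p (signal1 a b h) (signal2 c)) 3"
    using policy_stops[OF w(1)] stops_by_cong_3[of "\<lambda>t. Y1 t w" "signal1 a b h" "\<lambda>t. Y2 t w" "signal2 c" p]
    by simp_all
qed

text \<open>Every signal path has positive probability, so a wrong decision on a single one already
  makes the error probability positive.\<close>

lemma signal_correct:
  assumes noerr: "\<not> error_prob M H Y1 Y2 p > 0"
    and abc: "a \<in> {0, 1}" "b \<in> {0, 1}" "c \<in> {1, revealing h}"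
  shows "final_decision p (signal1 a b h) (signal2 c) = h"
proof (rule ccontr)
  assume wrong: "final_decision p (signal1 a b h) (signal2 c) \<noteq> h"
  let ?A = "{w \<in> space M. outcome w = (h, signal1 a b h, signal2 c)}"
  let ?E = "{w \<in> space M. final_decision p (\<lambda>t. Y1 t w) (\<lambda>t. Y2 t w) \<noteq> H w}"
  \<comment> \<open>The error event is a finite union of outcome events, hence measurable, as
    monotonicity of \<open>prob\<close> requires.\<close>
  have "?E = (\<Union>x\<in>{(h, y1, y2) \<in> outcomes. final_decision p y1 y2 \<noteq> h}. {w \<in> space M. outcome w = x})"
    using outcome_in final_decision_outcome by (fastforce simp: outcome_def)
  also have "\<dots> \<in> events"
    using outcome_event finite_outcomes by (intro sets.finite_UN) (auto intro: finite_subset)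
  finally have "prob ?A \<le> prob ?E"
    using wrong final_decision_outcome by (intro finite_measure_mono) (auto simp: outcome_def)
  moreover have "prob ?A > 0"
    using r by (simp add: signal_prob[OF abc])
  ultimately show False
    using noerr by (simp add: error_prob_def)
qed

text \<open>Pairs that err cost more than 2, which is at least \<open>v\<close>; for the others the
  pathwise bounds of \<open>cost_lower_bounds\<close> are averaged. Everything is thereby reduced to
  \<open>first_rule p\<close> at three values.\<close>

lemma expected_cost_lower_bound:
  assumes "v \<le> 2"
    and bound: "v \<le> (1 - r 1) * (if first_rule p 1 = None then K + 1 else 2) + r 1 / 2 * (\<Sum>c\<in>{0, 2}.
      if first_rule p c = None then K else if first_rule p c = first_rule p 1 then 2 else 1)"
  shows "v \<le> expected_cost M H Y1 Y2 K 1 J p"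
proof (cases "error_prob M H Y1 Y2 p > 0")
  case True
  then show ?thesis using error_costs[OF p] assms(1) by force
next
  case False
  define A where "A = (if first_rule p 1 = None then K + 1 else 2)"
  define B where "B c = (if first_rule p c = None then K else if first_rule p c = first_rule p 1 then 2 else 1)" for c
  have lower: "((1 - r 1) * A + r 1 * B (revealing h)) / 8 \<le>
      ((1 - r 1) * cost K 1 J p h (signal1 a b h) (signal2 1)
     + r 1 * cost K 1 J p h (signal1 a b h) (signal2 (revealing h))) / 8"
    if ab: "a \<in> {0, 1}" "b \<in> {0, 1}" for h a b
    using cost_lower_bounds[of K J p a b h, OF K_gt_k J_correct signal_stops[OF ab] signal_correct[OF False ab]] r
    unfolding A_def[symmetric] B_def[symmetric]
    by (intro divide_right_mono add_mono mult_left_mono) auto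
  \<comment> \<open>Each hypothesis contributes four equal terms, one per pair of tosses, so the
    weights 1/8 add up to \<open>1 - r 1\<close> on \<open>A\<close> and \<open>r 1 / 2\<close> on
    each of \<open>B 0\<close> and \<open>B 2\<close>.\<close>
  have "v \<le> (\<Sum>h\<in>UNIV. \<Sum>a\<in>{0, 1::nat}. \<Sum>b\<in>{0, 1::nat}. ((1 - r 1) * A + r 1 * B (revealing h)) / 8)"
    using bound unfolding A_def[symmetric] B_def[symmetric]
    by (simp add: UNIV_bit revealing_def field_simps)
  also have "\<dots> \<le> expected_cost M H Y1 Y2 K 1 J p"
    unfolding expected_cost_signals by (intro sum_mono lower)
  finally show ?thesis .
qed

text \<open>Each value 0, 1, 2 occurs at some sample point, so the rule fixes
  \<open>first_rule p\<close> there. The order flips because observing 0 reveals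
  \<open>H = 0\<close>, that is, belief 1.\<close>

lemma uses_rule_first_rule:
  assumes "uses_rule M H Y1 Y2 \<rho> p"
  shows "first_rule p 0 = \<rho> 1" "first_rule p 1 = \<rho> (1/2)" "first_rule p 2 = \<rho> 0"
proof -
  have *: "first_rule p c = \<rho> (belief M H Y2 c)" if c: "c \<in> {1, revealing h}" for h c
  proof -
    obtain w where w: "w \<in> space M" "outcome w = (h, signal1 0 0 h, signal2 c)"
      using signal_occurs[of 0 0 c h] c by auto
    then have "Y2 1 w = c"
      by (auto simp: outcome_def signal2_def dest!: fun_cong[where x = 1])
    with assms w(1) show ?thesis
      by (force simp: uses_rule_def U2_numeral first_rule_def)
  qed
  show "first_rule p 0 = \<rho> 1" "first_rule p 1 = \<rho> (1/2)" "first_rule p 2 = \<rho> 0"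
    using *[of 0 0] *[of 1 0] *[of 2 1] by (simp_all add: revealing_def belief_eq[unfolded One_nat_def])
qed

end

section \<open>Cost of relay pairs\<close>

lemma relay_policy: "relay d e \<in> policy_pairs M Y1 Y2 3"
  using relay_stops by (simp add: policy_pairs_def)

lemma relay_uses_rule:
  assumes "d 0 = \<rho> 1" "d 1 = \<rho> (1/2)" "d 2 = \<rho> 0"
  shows "uses_rule M H Y1 Y2 \<rho> (relay d e)"
  unfolding uses_rule_def
proof
  fix w assume "w \<in> space M"
  then have "Y2 1 w \<in> {0, 1, 2}" by (intro range2) simp_all
  with assms show "U2 (relay d e) (\<lambda>t. Y1 t w) (\<lambda>t. Y2 t w) 1 = \<rho> (belief M H Y2 (Y2 1 w))"
    unfolding relay_U2 by (auto simp: belief_eq[unfolded One_nat_def])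
qed

text \<open>The assumptions say that the uninformed announcement makes observer 1 wait and that
  every decoded announcement leads to the true hypothesis, which under a blank must be 0. The pair
  then never errs and no error cost remains.\<close>

lemma relay_expected_cost:
  assumes correct: "e (d 1) = None" "\<And>h. e (d (revealing h)) = None \<or>
      (if d (revealing h) = None then 0 else the (e (d (revealing h)))) = h"
  shows "expected_cost M H Y1 Y2 K 1 J (relay d e) =
    (1 - r 1) * (if d 1 = None then K + 1 else 2) + r 1 / 2 * (\<Sum>c\<in>{0, 2}.
      (if d c = None then K - 1 else 0) + (if e (d c) = None then 2 else 1))"
proof -
  define B where "B c = (if d c = None then K - 1 else 0) + (if e (d c) = None then 2 else 1)" for c
  have Jh: "J h h = 0" for h using J_correct by (cases h) auto
  have final: "final_decision (relay d e) (signal1 a b h) (signal2 c) = h" if "c \<in> {1, revealing h}" for a b c h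
    using correct(1) correct(2)[of h] that
    by (cases h) (auto simp: relay_final_decision signal1_def signal2_def split: option.split)
  have "cost K 1 J (relay d e) h (signal1 a b h) (signal2 c) = B c" if "c \<in> {1, revealing h}" for a b c h
    unfolding relay_cost final[OF that] Jh B_def by (simp add: signal2_def)
  then have "expected_cost M H Y1 Y2 K 1 J (relay d e) = (1 - r 1) * B 1 + r 1 / 2 * (\<Sum>c\<in>{0, 2}. B c)"
    unfolding expected_cost_signals[OF relay_policy] by (simp add: UNIV_bit revealing_def field_simps)
  then show ?thesis
    using correct(1) by (simp add: B_def)
qed

section \<open>The two restricted minima and their comparison\<close>

lemma two_threshold_lower_bound:
  assumes p: "p \<in> policy_pairs M Y1 Y2 3" and \<rho>: "two_threshold \<rho>" "uses_rule M H Y1 Y2 \<rho> p"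
  shows "min (r 1 + (1 - r 1) * (K + 1)) (2 - r 1 / 2) \<le> expected_cost M H Y1 Y2 K 1 J p"
proof (rule expected_cost_lower_bound[OF p])
  show "min (r 1 + (1 - r 1) * (K + 1)) (2 - r 1 / 2) \<le> 2"
    using r by linarith
  note rule = uses_rule_first_rule[OF p \<rho>(2)]
  note cases = two_threshold_cases[OF \<rho>(1)]
  define S where "S = (\<Sum>c\<in>{0, 2}.
    if first_rule p c = None then K else if first_rule p c = first_rule p 1 then 2 else 1)"
  have "min (r 1 + (1 - r 1) * (K + 1)) (2 - r 1 / 2) \<le>
    (1 - r 1) * (if first_rule p 1 = None then K + 1 else 2) + r 1 / 2 * S"
  proof (cases "first_rule p 1 = None")
    case True
    \<comment> \<open>Continuing at belief 1/2 leaves only the case of opposite terminal decisions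
      at the extreme beliefs, each contributing 1.\<close>
    then have "S = 2"
      using cases unfolding S_def by (auto simp: rule[unfolded One_nat_def])
    then show ?thesis using True by (simp add: min_le_iff_disj)
  next
    case False
    then obtain u where "\<rho> (1/2) = Some u" unfolding rule by blast
    moreover have "u = 0 \<or> u = 1" by (cases u) auto
    \<comment> \<open>One revealing signal shares the uninformed announcement and contributes 2; the
      other contributes at least 1.\<close>
    ultimately have "3 \<le> S"
      using cases unfolding S_def by (auto simp: rule[unfolded One_nat_def])
    then have "r 1 / 2 * 3 \<le> r 1 / 2 * S"
      using r by (intro mult_left_mono) auto
    then have "2 - r 1 / 2 \<le> (1 - r 1) * 2 + r 1 / 2 * S"
      by (simp add: field_simps)
    then show ?thesis unfolding if_not_P[OF False] by (rule min.coboundedI2)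
  qed
  then show "min (r 1 + (1 - r 1) * (K + 1)) (2 - r 1 / 2) \<le>
    (1 - r 1) * (if first_rule p 1 = None then K + 1 else 2) + r 1 / 2 * (\<Sum>c\<in>{0, 2}.
      if first_rule p c = None then K else if first_rule p c = first_rule p 1 then 2 else 1)"
    unfolding S_def .
qed

lemma lowest_cost_two_threshold:
  "lowest_cost (expected_cost M H Y1 Y2 K 1 J)
    {p \<in> policy_pairs M Y1 Y2 3. \<exists>\<rho>. two_threshold \<rho> \<and> uses_rule M H Y1 Y2 \<rho> p}
    (min (r 1 + (1 - r 1) * (K + 1)) (2 - r 1 / 2))"
proof -
  let ?P = "{p \<in> policy_pairs M Y1 Y2 3. \<exists>\<rho>. two_threshold \<rho> \<and> uses_rule M H Y1 Y2 \<rho> p}"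
  let ?C = "expected_cost M H Y1 Y2 K 1 J"
  \<comment> \<open>\<open>p\<close> announces all three observations distinctly, using the blank
    for the uninformative one; this attains the first entry of the minimum.\<close>
  define p where "p = relay (\<lambda>y. if y = 0 then Some 0 else if y = 2 then Some 1 else None) id"
  \<comment> \<open>\<open>p'\<close> merges the uninformative value with 2 and always stops at time
    1, so only the value 0 lets observer 1 stop early; this attains the second entry.\<close>
  define p' where "p' = relay (\<lambda>y. if y = 0 then Some 0 else Some 1) (\<lambda>u. if u = Some 0 then Some 0 else None)"
  have "two_threshold (\<lambda>\<pi>. if \<pi> \<le> 0 then Some 1 else if \<pi> < 1 then None else Some 0)"
    unfolding two_threshold_def by (rule exI[of _ 0], rule exI[of _ 1]) auto
  moreover have "uses_rule M H Y1 Y2 (\<lambda>\<pi>. if \<pi> \<le> 0 then Some 1 else if \<pi> < 1 then None else Some 0) p"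
    unfolding p_def by (rule relay_uses_rule) auto
  ultimately have p: "p \<in> ?P" using relay_policy unfolding p_def by blast
  \<comment> \<open>Any threshold strictly between the beliefs 1/2 and 1 would serve.\<close>
  have "two_threshold (\<lambda>\<pi>. if \<pi> \<le> 3/4 then Some 1 else Some 0)"
    unfolding two_threshold_def by (rule exI[of _ "3/4"], rule exI[of _ "3/4"]) auto
  moreover have "uses_rule M H Y1 Y2 (\<lambda>\<pi>. if \<pi> \<le> 3/4 then Some 1 else Some 0) p'"
    unfolding p'_def by (rule relay_uses_rule) auto
  ultimately have p': "p' \<in> ?P" using relay_policy unfolding p'_def by blast
  have C: "?C p = r 1 + (1 - r 1) * (K + 1)" "?C p' = 2 - r 1 / 2"
    unfolding p_def p'_def
    by (subst relay_expected_cost; auto simp: revealing_def field_simps)+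
  show ?thesis
  proof (cases "r 1 + (1 - r 1) * (K + 1) \<le> 2 - r 1 / 2")
    case True
    then show ?thesis
      using C(1) two_threshold_lower_bound by (intro lowest_costI[OF p]) auto
  next
    case False
    then show ?thesis
      using C(2) two_threshold_lower_bound by (intro lowest_costI[OF p']) auto
  qed
qed

text \<open>The three beliefs receive three different announcements and the uninformed one stops at
  once, so the lower bound charges 2 when uninformed, \<open>K\<close> on the signal 0 and 1 on the
  signal 2. Decoding attains all three.\<close>

lemma lowest_cost_inverted_rule:
  "lowest_cost (expected_cost M H Y1 Y2 K 1 J)
    {p \<in> policy_pairs M Y1 Y2 3. uses_rule M H Y1 Y2
      (\<lambda>\<pi>. if \<pi> = 0 then Some 1 else if \<pi> < 1 then Some 0 else None) p}
    (2 * (1 - r 1) + r 1 * (K + 1) / 2)"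
proof -
  let ?\<rho> = "\<lambda>\<pi>::real. if \<pi> = 0 then Some 1 else if \<pi> < 1 then Some 0 else None :: decision"
  \<comment> \<open>A blank tells observer 1 that \<open>H = 0\<close>; both then stop at time 2,
    and observer 2's second decision 0 is the final one.\<close>
  define p where "p = relay (\<lambda>y. if y = 2 then Some 1 else if y = 1 then Some 0 else None)
    (\<lambda>u. if u = Some 1 then Some 1 else if u = None then Some 0 else None)"
  have "uses_rule M H Y1 Y2 ?\<rho> p"
    unfolding p_def by (rule relay_uses_rule) auto
  moreover have "expected_cost M H Y1 Y2 K 1 J p = 2 * (1 - r 1) + r 1 * (K + 1) / 2"
    unfolding p_def by (subst relay_expected_cost) (auto simp: revealing_def field_simps)
  moreover have "2 * (1 - r 1) + r 1 * (K + 1) / 2 \<le> expected_cost M H Y1 Y2 K 1 J p'"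
    if p': "p' \<in> policy_pairs M Y1 Y2 3" "uses_rule M H Y1 Y2 ?\<rho> p'" for p'
  proof (rule expected_cost_lower_bound[OF p'(1)])
    have "r 1 * K \<le> r 1 * 2" using r K_less_2 by (intro mult_left_mono) auto
    then show "2 * (1 - r 1) + r 1 * (K + 1) / 2 \<le> 2" using r by (simp add: algebra_simps)
  qed (use r in \<open>simp add: uses_rule_first_rule[OF p', unfolded One_nat_def] field_simps\<close>)
  ultimately show ?thesis
    using relay_policy unfolding p_def by (intro lowest_costI) auto
qed

lemma inverted_rule_cost_less:
  assumes "r 1 < 2/3"
  shows "2 * (1 - r 1) + r 1 * (K + 1) / 2 < min (r 1 + (1 - r 1) * (K + 1)) (2 - r 1 / 2)"
proof -
  \<comment> \<open>The first product is the gap to the first entry of the minimum; the second is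
    twice the gap to the second entry.\<close>
  have "0 < (K - 1) * (1 - 3/2 * r 1)" "0 < r 1 * (2 - K)"
    using assms K_less_2 K_gt_k r by (auto intro!: mult_pos_pos)
  then show ?thesis by (simp add: field_simps)
qed

end

theorem mainTheorem2:
  fixes M :: "'w measure"
    and H :: "'w \<Rightarrow> bit"
    and Y1 Y2 :: "nat \<Rightarrow> 'w \<Rightarrow> nat"
    and K :: real
    and J :: "bit \<Rightarrow> bit \<Rightarrow> real"
    and q r :: "nat \<Rightarrow> real"
  assumes model: "two_observer_detection M H Y1 Y2 3 K 1 J"
    and K: "1 < K" "K < 2"
    and prior: "\<P>(w in M. H w = 0) = 1/2" "\<P>(w in M. H w = 1) = 1/2"
    and range1: "\<And>t w. t \<in> {1..3} \<Longrightarrow> w \<in> space M \<Longrightarrow> Y1 t w \<in> {0, 1}"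
    and range2: "\<And>t w. t \<in> {1..3} \<Longrightarrow> w \<in> space M \<Longrightarrow> Y2 t w \<in> {0, 1, 2}"
    and obs1: "\<And>t. t \<in> {1..3} \<Longrightarrow>
        \<P>(w in M. Y1 t w = 0 \<bar> H w = 0) = q t \<and> \<P>(w in M. Y1 t w = 1 \<bar> H w = 1) = q t \<and>
        \<P>(w in M. Y1 t w = 1 \<bar> H w = 0) = 1 - q t \<and> \<P>(w in M. Y1 t w = 0 \<bar> H w = 1) = 1 - q t"
    and q: "q 1 = 1/2" "q 2 = 1/2" "q 3 = 1"
    and obs2: "\<And>t. t \<in> {1..3} \<Longrightarrow>
        \<P>(w in M. Y2 t w = 0 \<bar> H w = 0) = r t \<and> \<P>(w in M. Y2 t w = 1 \<bar> H w = 0) = 1 - r t \<and>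
        \<P>(w in M. Y2 t w = 2 \<bar> H w = 0) = 0 \<and>
        \<P>(w in M. Y2 t w = 0 \<bar> H w = 1) = 0 \<and> \<P>(w in M. Y2 t w = 1 \<bar> H w = 1) = 1 - r t \<and>
        \<P>(w in M. Y2 t w = 2 \<bar> H w = 1) = r t"
    and r: "0 < r 1" "r 1 < 1" "r 2 = 0" "r 3 = 0"
    and error_costs: "\<And>p. p \<in> policy_pairs M Y1 Y2 3 \<Longrightarrow> error_prob M H Y1 Y2 p > 0 \<Longrightarrow>
        expected_cost M H Y1 Y2 K 1 J p > 2"
  shows "lowest_cost (expected_cost M H Y1 Y2 K 1 J)
           {p \<in> policy_pairs M Y1 Y2 3. \<exists>\<rho>. two_threshold \<rho> \<and> uses_rule M H Y1 Y2 \<rho> p}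
           (min (r 1 + (1 - r 1) * (K + 1)) (2 - r 1 / 2))
       \<and> lowest_cost (expected_cost M H Y1 Y2 K 1 J)
           {p \<in> policy_pairs M Y1 Y2 3. uses_rule M H Y1 Y2
              (\<lambda>\<pi>. if \<pi> = 0 then Some 1 else if \<pi> < 1 then Some 0 else None) p}
           (2 * (1 - r 1) + r 1 * (K + 1) / 2)
       \<and> (r 1 < 2/3 \<longrightarrow>
            2 * (1 - r 1) + r 1 * (K + 1) / 2
              < min (r 1 + (1 - r 1) * (K + 1)) (2 - r 1 / 2))
       \<and> (r 1 < 2/3 \<longrightarrow>
            \<not> (\<exists>p \<rho>. is_arg_min (expected_cost M H Y1 Y2 K 1 J)
                        (\<lambda>p. p \<in> policy_pairs M Y1 Y2 3) p
                   \<and> two_threshold \<rho> \<and> uses_rule M H Y1 Y2 \<rho> p))"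
proof -
  interpret detection_instance M H Y1 Y2 K J q r
    by (intro detection_instance.intro detection_instance_axioms.intro; fact)
  have "\<not> is_arg_min (expected_cost M H Y1 Y2 K 1 J) (\<lambda>p. p \<in> policy_pairs M Y1 Y2 3) p"
    if "r 1 < 2/3" "two_threshold \<rho>" "uses_rule M H Y1 Y2 \<rho> p" for p \<rho>
  proof
    assume opt: "is_arg_min (expected_cost M H Y1 Y2 K 1 J) (\<lambda>p. p \<in> policy_pairs M Y1 Y2 3) p"
    \<comment> \<open>Since the lowest cost in (ii) is attained, an actual pair undercuts every
      two-threshold pair, which contradicts optimality of \<open>p\<close>.\<close>
    obtain p' where p': "p' \<in> policy_pairs M Y1 Y2 3"
      "expected_cost M H Y1 Y2 K 1 J p' = 2 * (1 - r 1) + r 1 * (K + 1) / 2"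
      using lowest_cost_inverted_rule unfolding lowest_cost_def is_arg_min_def by blast
    have "expected_cost M H Y1 Y2 K 1 J p' < expected_cost M H Y1 Y2 K 1 J p"
      using inverted_rule_cost_less[OF that(1)] two_threshold_lower_bound[OF _ that(2,3)] opt
      unfolding p'(2) is_arg_min_def by (blast intro: less_le_trans)
    with opt p'(1) show False
      unfolding is_arg_min_def by blast
  qed
  then show ?thesis
    using lowest_cost_two_threshold lowest_cost_inverted_rule inverted_rule_cost_less by blast
qed

end
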